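(* Let $f:\mathbb{R}^d\to\mathbb{R}$ be an $L$-smooth convex function having a minimizer $x_\star$, and let $f_\star=f(x_\star)$. Let $\{\tau_k\}_{k\ge0}$, $\{\alpha_k\}_{k\ge0}$ be real sequences and $B_0>0$, and let $A_k$, $B_k$ be defined from them as in the context. Suppose that for some $r>0$ and all $k\ge0$, $$0<\alpha_k\le1,\qquad\frac{\tau_k^2}{\tau_{k+1}(\tau_{k+1}-1)}\ge1,\qquad\left(\frac{A_k}{B_k}+\frac{B_{k+1}+\alpha_{k+1}^2\tau_{k+1}^2}{A_k}\right)^{-1}\ge\frac{r}{\alpha_{k+1}}.$$ Let $x_0\ne\tilde x_0$ and $L_0=\|\nabla f(x_0)-\nabla f(\tilde x_0)\|/\|x_0-\tilde x_0\|>0$, set $s_0=\frac{A_0}{\alpha_0\tau_0}\frac{r}{\alpha_1}\frac1{L_0}$, and let $$R=\|x_0-x_\star\|^2+\left(s_0^2(B_0+\alpha_0^2\tau_0^2)-\frac{s_0\alpha_0\tau_0}{2L}\right)\|\nabla f(x_0)\|^2 .$$ Then the sequences generated by AdaNAG-G (defined in the context) from $x_0$ and $s_0$ satisfy $s_{k+1}\alpha_{k+1}\ge\frac rL$ for all $k\ge0$, and $$f(x_k)-f_\star\le\frac{1}{2s_{k+1}A_k}R=\mathcal{O}\left(\frac{L}{\alpha_k\tau_k^2}\right),\qquad\min_{i\in\{1,\dots,k\}}\|\nabla f(x_i)\|^2\le\mathcal{O}\left(\frac{L^2}{\sum_{i=1}^k\alpha_i\tau_i^2}\right).$$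
   Context: $f$ is $L$-smooth ($L>0$) if it is differentiable and $\nabla f$ is $L$-Lipschitz. AdaNAG-G with parameters $\{\tau_k\},\{\alpha_k\},B_0>0$: put $A_{-1}=0$, $A_k=\alpha_{k+1}\tau_{k+1}(\tau_{k+1}-1)$ for $k\ge0$, and $B_k=\alpha_k^2\tau_k^2\left(\frac{(\tau_k-1)^2}{\alpha_{k-1}\tau_{k-1}^2}-1\right)$ for $k\ge1$. Given $x_0=z_0\in\mathbb{R}^d$ and $s_0>0$, for $k=0,1,2,\dots$: $$y_{k+1}=x_k-s_k\nabla f(x_k),\quad z_{k+1}=z_k-s_k\alpha_k\tau_k\nabla f(x_k),\quad x_{k+1}=\left(1-\tfrac1{\tau_{k+1}}\right)y_{k+1}+\tfrac1{\tau_{k+1}}z_{k+1},$$ $$L_{k+1}=-\frac{\frac12\|\nabla f(x_{k+1})-\nabla f(x_k)\|^2}{f(x_{k+1})-f(x_k)+\langle\nabla f(x_{k+1}),x_k-x_{k+1}\rangle},$$ $$s_{k+1}=\min\left\{\frac{A_{k-1}+\alpha_k\tau_k}{A_k}s_k,\ \left(\frac{A_k}{B_k}+\frac{B_{k+1}+\alpha_{k+1}^2\tau_{k+1}^2}{A_k}\right)^{-1}\frac1{L_{k+1}}\right\}.$$ Conventions: $\frac00=0$ and $\frac a0=+\infty$ for $a>0$.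
   Formalization: The formal theorem takes all τ_k to be positive and additionally assumes τ_0 ≥ 1/2; for small τ_0 (e.g. τ_0 = 1/100 with a Huber function) the explicit bound f(x_k) − f_⋆ ≤ R/(2 s_{k+1} A_k) can fail at k = 1. *)

theory Defs
  imports "HOL-Analysis.Analysis"
begin

definition grad :: "('a::real_inner \<Rightarrow> real) \<Rightarrow> 'a \<Rightarrow> 'a" where
  "grad f x = (THE D. GDERIV f x :> D)"

definition L_smooth :: "real \<Rightarrow> ('a::euclidean_space \<Rightarrow> real) \<Rightarrow> bool" where
  "L_smooth L f \<longleftrightarrow> L > 0 \<and> (\<forall>x. f differentiable (at x)) \<and> L-lipschitz_on UNIV (grad f)"

definition A_coef :: "(nat \<Rightarrow> real) \<Rightarrow> (nat \<Rightarrow> real) \<Rightarrow> nat \<Rightarrow> real" where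
  "A_coef \<alpha> \<tau> k = \<alpha> (k + 1) * \<tau> (k + 1) * (\<tau> (k + 1) - 1)"

text \<open>\<open>A_prev \<alpha> \<tau> k\<close> is \<open>A\<close> at index \<open>k - 1\<close>, with value \<open>0\<close> at index \<open>-1\<close>.\<close>

definition A_prev :: "(nat \<Rightarrow> real) \<Rightarrow> (nat \<Rightarrow> real) \<Rightarrow> nat \<Rightarrow> real" where
  "A_prev \<alpha> \<tau> k = (if k = 0 then 0 else A_coef \<alpha> \<tau> (k - 1))"

definition B_coef :: "real \<Rightarrow> (nat \<Rightarrow> real) \<Rightarrow> (nat \<Rightarrow> real) \<Rightarrow> nat \<Rightarrow> real" where
  "B_coef B0 \<alpha> \<tau> k =
     (if k = 0 then B0
      else (\<alpha> k)\<^sup>2 * (\<tau> k)\<^sup>2 * ((\<tau> k - 1)\<^sup>2 / (\<alpha> (k - 1) * (\<tau> (k - 1))\<^sup>2) - 1))"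

text \<open>
  Division in \<^typ>\<open>ereal\<close> satisfies \<open>0 / 0 = 0\<close> and \<open>a / 0 = \<infinity>\<close> for \<open>a > 0\<close>, which are the
  conventions intended for the step-size rule. In particular a lower bound \<open>> 0\<close> on the
  following quantity excludes \<open>B_coef B0 \<alpha> \<tau> k = 0\<close> when \<open>A_coef \<alpha> \<tau> k > 0\<close>; division in
  \<^typ>\<open>real\<close> would not.
\<close>

definition step_coef :: "real \<Rightarrow> (nat \<Rightarrow> real) \<Rightarrow> (nat \<Rightarrow> real) \<Rightarrow> nat \<Rightarrow> ereal" where
  "step_coef B0 \<alpha> \<tau> k =
     inverse (ereal (A_coef \<alpha> \<tau> k) / ereal (B_coef B0 \<alpha> \<tau> k) +
              ereal (B_coef B0 \<alpha> \<tau> (k + 1) + (\<alpha> (k + 1))\<^sup>2 * (\<tau> (k + 1))\<^sup>2) / ereal (A_coef \<alpha> \<tau> k))"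

text \<open>
  Local smoothness estimate from the current point \<open>u\<close> and the next point \<open>v\<close>. For convex
  \<open>L\<close>-smooth \<open>f\<close> the denominator can only vanish together with the numerator, and then the
  value is \<open>0 / 0 = 0\<close>.
\<close>

definition local_L :: "('a::euclidean_space \<Rightarrow> real) \<Rightarrow> 'a \<Rightarrow> 'a \<Rightarrow> real" where
  "local_L f u v =
     - ((1 / 2 * (norm (grad f v - grad f u))\<^sup>2) / (f v - f u + grad f v \<bullet> (u - v)))"

definition AdaNAG_G ::
  "real \<Rightarrow> (nat \<Rightarrow> real) \<Rightarrow> (nat \<Rightarrow> real) \<Rightarrow> ('a::euclidean_space \<Rightarrow> real) \<Rightarrow> 'a \<Rightarrow> real \<Rightarrow>
   (nat \<Rightarrow> 'a) \<Rightarrow> (nat \<Rightarrow> 'a) \<Rightarrow> (nat \<Rightarrow> 'a) \<Rightarrow> (nat \<Rightarrow> real) \<Rightarrow> bool" where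
  "AdaNAG_G B0 \<alpha> \<tau> f x0 s0 x y z s \<longleftrightarrow>
     x 0 = x0 \<and> z 0 = x0 \<and> s 0 = s0 \<and>
     (\<forall>k. y (k + 1) = x k - s k *\<^sub>R grad f (x k) \<and>
          z (k + 1) = z k - (s k * \<alpha> k * \<tau> k) *\<^sub>R grad f (x k) \<and>
          x (k + 1) = (1 - 1 / \<tau> (k + 1)) *\<^sub>R y (k + 1) + (1 / \<tau> (k + 1)) *\<^sub>R z (k + 1) \<and>
          ereal (s (k + 1)) =
            min (ereal ((A_prev \<alpha> \<tau> k + \<alpha> k * \<tau> k) / A_coef \<alpha> \<tau> k * s k))
                (step_coef B0 \<alpha> \<tau> k * (1 / ereal (local_L f (x k) (x (k + 1))))))"

end

theory Submission
  imports Defs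
begin

text \<open>
  Positivity of the step coefficients forces all \<open>B\<^bsub>k\<^esub>\<close> to be positive, and the descent quantity is
  \<open>W\<^bsub>k\<^esub> = \<parallel>z\<^bsub>k+1\<^esub> - x\<^sub>\<star>\<parallel>\<^sup>2 + 2 s\<^bsub>k+1\<^esub> A\<^bsub>k\<^esub> (f(x\<^bsub>k\<^esub>) - f\<^sub>\<star>) + s\<^bsub>k\<^esub>\<^sup>2 B\<^bsub>k\<^esub> \<parallel>\<nabla>f(x\<^bsub>k\<^esub>)\<parallel>\<^sup>2\<close>, with \<open>W\<^sub>0 \<le> R\<close>.
  The first argument of the step-size minimum makes the coefficient of \<open>f(x\<^bsub>k+1\<^esub>) - f\<^sub>\<star>\<close> in
  \<open>W\<^bsub>k+1\<^esub> - W\<^bsub>k\<^esub>\<close> nonpositive; the second one leaves a quadratic form in the two gradients. With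
  \<open>T = s\<^bsub>k+1\<^esub> A\<^bsub>k\<^esub>\<close> this form is at most
  \<open>- T (2 s\<^bsub>k\<^esub> - T / (\<alpha>\<^bsub>k\<^esub> \<tau>\<^bsub>k\<^esub>\<^sup>2)) \<parallel>\<nabla>f(x\<^bsub>k\<^esub>)\<parallel>\<^sup>2\<close>. For \<open>k \<ge> 1\<close> the bracket is at least
  \<open>s\<^bsub>k\<^esub> \<ge> r / L\<close>, so the decrease of \<open>W\<close> dominates \<open>(r / L)\<^sup>2 \<alpha>\<^bsub>k\<^esub> \<tau>\<^bsub>k\<^esub>\<^sup>2 \<parallel>\<nabla>f(x\<^bsub>k\<^esub>)\<parallel>\<^sup>2\<close>,
  which sums to the gradient bound; for \<open>k = 0\<close> it is nonnegative because \<open>\<tau>\<^sub>0 \<ge> 1/2\<close>.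
\<close>

section \<open>Gradients of smooth convex functions\<close>

text \<open>Riesz representation in coordinates: the derivative is the inner product with
  \<open>D\<close>, and uniqueness of derivatives makes the description operator in
  \<open>grad\<close> return \<open>D\<close>.\<close>

lemma gderiv_grad:
  fixes f :: "'a::euclidean_space \<Rightarrow> real"
  assumes "f differentiable (at x)"
  shows "GDERIV f x :> grad f x"
proof -
  obtain f' where f': "(f has_derivative f') (at x)"
    using assms by (auto simp: differentiable_def)
  then have lin: "linear f'"
    by (rule has_derivative_linear)
  define D where "D = (\<Sum>b\<in>Basis. f' b *\<^sub>R b)"
  have "f' h = h \<bullet> D" for h
  proof -
    have "f' h = f' (\<Sum>b\<in>Basis. (h \<bullet> b) *\<^sub>R b)"
      by (simp add: euclidean_representation)
    also have "\<dots> = (\<Sum>b\<in>Basis. (h \<bullet> b) * f' b)"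
      using lin by (simp add: linear_sum linear_scale)
    also have "\<dots> = h \<bullet> D"
      by (simp add: D_def inner_sum_right mult.commute)
    finally show ?thesis .
  qed
  then have "f' = (\<lambda>h. h \<bullet> D)" by auto
  then have D: "GDERIV f x :> D"
    using f' by (simp add: gderiv_def)
  have "D' = D" if "GDERIV f x :> D'" for D'
  proof -
    have "(\<lambda>h. h \<bullet> D') = (\<lambda>h. h \<bullet> D)"
      using that D unfolding gderiv_def by (rule has_derivative_unique)
    then have "\<forall>h. h \<bullet> D' = h \<bullet> D" by (simp add: fun_eq_iff)
    then show ?thesis by (simp only: vector_eq_ldot)
  qed
  with D show ?thesis
    unfolding grad_def by (rule theI)
qed

lemma DERIV_along_line:
  assumes "GDERIV f (x + t *\<^sub>R v) :> D"
  shows "((\<lambda>t. f (x + t *\<^sub>R v)) has_real_derivative (v \<bullet> D)) (at t)"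
proof -
  have "((\<lambda>t. x + t *\<^sub>R v) has_derivative (\<lambda>h. h *\<^sub>R v)) (at t)"
    by (auto intro!: derivative_eq_intros)
  from has_derivative_compose[OF this assms[unfolded gderiv_def]]
  have "((\<lambda>t. f (x + t *\<^sub>R v)) has_derivative (\<lambda>h. (h *\<^sub>R v) \<bullet> D)) (at t)" .
  then show ?thesis
    by (simp add: has_field_derivative_def mult_commute_abs)
qed

locale smooth_convex =
  fixes f :: "'a::euclidean_space \<Rightarrow> real" and L :: real
  assumes convex: "convex_on UNIV f" and smooth: "L_smooth L f"
begin

lemma L_pos: "L > 0"
  using smooth by (simp add: L_smooth_def)

lemma gderiv: "GDERIV f x :> grad f x"
  using smooth gderiv_grad by (auto simp: L_smooth_def)

lemma grad_lipschitz: "norm (grad f x - grad f y) \<le> L * norm (x - y)"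
  using smooth lipschitz_onD[of L UNIV "grad f" x y] by (simp add: L_smooth_def dist_norm)

lemma above_tangent: "f x + grad f x \<bullet> (y - x) \<le> f y"
proof -
  define v where "v = y - x"
  define h where "h = (\<lambda>t::real. f (x + t *\<^sub>R v))"
  have "convex_on UNIV h"
  proof (rule convex_onI)
    fix t a b :: real
    assume t: "0 < t" "t < 1"
    have "x + ((1 - t) * a + t * b) *\<^sub>R v = (1 - t) *\<^sub>R (x + a *\<^sub>R v) + t *\<^sub>R (x + b *\<^sub>R v)"
      by (simp add: algebra_simps)
    then show "h ((1 - t) *\<^sub>R a + t *\<^sub>R b) \<le> (1 - t) * h a + t * h b"
      unfolding h_def using convex_onD[OF convex, of t "x + a *\<^sub>R v" "x + b *\<^sub>R v"] t by simp
  qed simp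
  moreover have "(h has_real_derivative (v \<bullet> grad f x)) (at 0)"
    unfolding h_def using DERIV_along_line[of f x 0 v] gderiv by simp
  ultimately have "h 1 - h 0 \<ge> (v \<bullet> grad f x) * (1 - 0)"
    by (intro convex_on_imp_above_tangent[where A = UNIV]) auto
  then show ?thesis
    by (simp add: h_def v_def inner_commute)
qed

text \<open>Along the segment from \<open>x\<close> to \<open>y\<close> the excess of
  \<open>f\<close> over its quadratic model is nonincreasing, by the Lipschitz bound on its
  derivative.\<close>

lemma descent: "f y \<le> f x + grad f x \<bullet> (y - x) + L / 2 * (norm (y - x))\<^sup>2"
proof -
  define v where "v = y - x"
  define h where "h = (\<lambda>t::real. f (x + t *\<^sub>R v) - (t * (v \<bullet> grad f x) + L / 2 * t\<^sup>2 * (norm v)\<^sup>2))"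
  have "h 1 \<le> h 0"
  proof (rule DERIV_nonpos_imp_nonincreasing[of 0 1 h])
    fix t :: real
    assume t: "0 \<le> t" "t \<le> 1"
    have "(h has_real_derivative
        (v \<bullet> grad f (x + t *\<^sub>R v) - (v \<bullet> grad f x + L * t * (norm v)\<^sup>2))) (at t)"
      unfolding h_def by (rule derivative_eq_intros DERIV_along_line gderiv refl | simp)+
    moreover have "v \<bullet> (grad f (x + t *\<^sub>R v) - grad f x) \<le> norm v * (L * (t * norm v))"
    proof -
      have "v \<bullet> (grad f (x + t *\<^sub>R v) - grad f x) \<le> norm v * norm (grad f (x + t *\<^sub>R v) - grad f x)"
        by (rule norm_cauchy_schwarz)
      also have "\<dots> \<le> norm v * (L * (t * norm v))"
        using grad_lipschitz[of "x + t *\<^sub>R v" x] t by (intro mult_left_mono) auto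
      finally show ?thesis .
    qed
    ultimately show "\<exists>y. (h has_real_derivative y) (at t) \<and> y \<le> 0"
      by (intro exI conjI) (auto simp: inner_diff_right power2_eq_square algebra_simps)
  qed simp
  then show ?thesis
    by (simp add: h_def v_def inner_commute)
qed

text \<open>The function \<open>f - \<langle>\<nabla>f x, \<cdot>\<rangle>\<close> is minimal at \<open>x\<close>; compare with its value after one
  gradient step of length \<open>1 / L\<close> from \<open>y\<close>.\<close>

lemma cocoercive:
  "f x + grad f x \<bullet> (y - x) + (norm (grad f y - grad f x))\<^sup>2 / (2 * L) \<le> f y"
proof -
  define d where "d = grad f y - grad f x"
  define w where "w = y - (1 / L) *\<^sub>R d"
  have "f x + grad f x \<bullet> (w - x) \<le> f w"
    by (rule above_tangent)
  also have "f w \<le> f y + grad f y \<bullet> (w - y) + L / 2 * (norm (w - y))\<^sup>2"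
    by (rule descent)
  also have "grad f y \<bullet> (w - y) = - (grad f y \<bullet> d) / L"
    by (simp add: w_def)
  also have "L / 2 * (norm (w - y))\<^sup>2 = (norm d)\<^sup>2 / (2 * L)"
    using L_pos by (simp add: w_def power_divide field_simps power2_eq_square)
  also have "grad f x \<bullet> (w - x) = grad f x \<bullet> (y - x) - (grad f x \<bullet> d) / L"
    by (simp add: w_def inner_diff_right)
  finally have "f x + grad f x \<bullet> (y - x) + ((grad f y \<bullet> d) - (grad f x \<bullet> d)) / L - (norm d)\<^sup>2 / (2 * L) \<le> f y"
    by (simp add: diff_divide_distrib)
  moreover have "(grad f y \<bullet> d) - (grad f x \<bullet> d) = (norm d)\<^sup>2"
    by (simp add: d_def power2_norm_eq_inner inner_diff_left)
  ultimately show ?thesis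
    by (simp add: d_def)
qed

text \<open>A nonzero gradient would let a gradient step of length \<open>1 / L\<close> lower
  \<open>f\<close> strictly.\<close>

lemma grad_minimizer:
  assumes "\<And>u. f xs \<le> f u"
  shows "grad f xs = 0"
proof -
  have "f xs \<le> f (xs - (1 / L) *\<^sub>R grad f xs)" by (rule assms)
  also have "\<dots> \<le> f xs - (norm (grad f xs))\<^sup>2 / L + L / 2 * (norm (grad f xs) / L)\<^sup>2"
    using descent[of "xs - (1 / L) *\<^sub>R grad f xs" xs] L_pos
    by (simp add: power2_norm_eq_inner)
  also have "\<dots> = f xs - (norm (grad f xs))\<^sup>2 / (2 * L)"
    using L_pos by (simp add: field_simps power2_eq_square)
  finally show ?thesis
    using L_pos by (simp add: field_simps)
qed

text \<open>Cocoercivity gives \<open>N \<le> 2 * L * D\<close>, so \<open>D = 0\<close> forces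
  \<open>N = 0\<close> and the product identity survives division by zero.\<close>

lemma local_L_bounds:
  shows "local_L f u v \<ge> 0" "local_L f u v \<le> L"
    and "local_L f u v * (f u - f v - grad f v \<bullet> (u - v)) = (norm (grad f v - grad f u))\<^sup>2 / 2"
proof -
  define N where "N = (norm (grad f v - grad f u))\<^sup>2"
  define D where "D = f u - f v - grad f v \<bullet> (u - v)"
  have ND: "N / (2 * L) \<le> D"
    using cocoercive[of v u] by (simp add: N_def D_def norm_minus_commute)
  have N: "N \<ge> 0" by (simp add: N_def)
  have "f v - f u + grad f v \<bullet> (u - v) = - D"
    by (simp add: D_def)
  then have l: "local_L f u v = N / 2 / D"
    by (simp add: local_L_def N_def)
  have D: "D \<ge> 0"
    using ND N L_pos by (meson divide_nonneg_pos mult_pos_pos order_trans zero_less_numeral)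
  show "local_L f u v \<ge> 0"
    using l N D by simp
  have NL: "N \<le> 2 * L * D"
    using ND L_pos by (simp add: field_simps)
  show "local_L f u v \<le> L"
    using l D L_pos NL by (cases "D = 0") (auto simp: field_simps)
  show "local_L f u v * (f u - f v - grad f v \<bullet> (u - v)) = (norm (grad f v - grad f u))\<^sup>2 / 2"
    using l NL N by (cases "D = 0") (auto simp flip: N_def D_def)
qed

end

section \<open>Parameters\<close>

locale adanag_params =
  fixes B0 r :: real and \<alpha> \<tau> :: "nat \<Rightarrow> real"
  assumes B0_pos: "B0 > 0" and r_pos: "r > 0"
    and \<tau>_pos: "\<tau> k > 0" and \<tau>0: "\<tau> 0 \<ge> 1 / 2"
    and \<alpha>_pos: "0 < \<alpha> k" and \<alpha>_le: "\<alpha> k \<le> 1"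
    and \<tau>_ratio: "(\<tau> k)\<^sup>2 / (\<tau> (k + 1) * (\<tau> (k + 1) - 1)) \<ge> 1"
    and step_coef_ge: "step_coef B0 \<alpha> \<tau> k \<ge> ereal (r / \<alpha> (k + 1))"
begin

abbreviation "A \<equiv> A_coef \<alpha> \<tau>"
abbreviation "B \<equiv> B_coef B0 \<alpha> \<tau>"
text \<open>Reciprocal of the step coefficient, its second summand simplified by
  \<open>B_Suc\<close>.\<close>

abbreviation "c k \<equiv> A k / B k + A k / (\<alpha> k * (\<tau> k)\<^sup>2)"

lemma \<tau>_gt1: "\<tau> (Suc k) > 1"
proof (rule ccontr)
  assume "\<not> \<tau> (Suc k) > 1"
  then have "\<tau> (Suc k) * (\<tau> (Suc k) - 1) \<le> 0"
    using \<tau>_pos[of "Suc k"] by (simp add: mult_le_0_iff)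
  then have "(\<tau> k)\<^sup>2 / (\<tau> (k + 1) * (\<tau> (k + 1) - 1)) \<le> 0"
    by (simp add: divide_le_0_iff)
  with \<tau>_ratio[of k] show False by simp
qed

lemma \<tau>_prod_pos: "\<tau> (Suc k) * (\<tau> (Suc k) - 1) > 0"
  using \<tau>_gt1[of k] by simp

lemma \<tau>_prod_le: "\<tau> (Suc k) * (\<tau> (Suc k) - 1) \<le> (\<tau> k)\<^sup>2"
  using \<tau>_ratio[of k] \<tau>_prod_pos[of k] by (simp add: le_divide_eq)

lemma A_eq: "A k = \<alpha> (Suc k) * (\<tau> (Suc k) * (\<tau> (Suc k) - 1))"
  by (simp add: A_coef_def mult.assoc)

lemma A_pos: "A k > 0"
  using \<tau>_prod_pos[of k] \<alpha>_pos[of "Suc k"] by (simp only: A_eq mult_pos_pos)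

lemma \<alpha>\<tau>_pos: "\<alpha> k * (\<tau> k)\<^sup>2 > 0"
  using \<alpha>_pos[of k] \<tau>_pos[of k] by simp

text \<open>The \<open>- 1\<close> in the definition of \<open>B\<close> cancels against the added
  term. The same sum multiplies the newest squared gradient norm in \<open>W_step\<close>.\<close>

lemma B_Suc: "B (Suc k) + (\<alpha> (Suc k))\<^sup>2 * (\<tau> (Suc k))\<^sup>2 = (A k)\<^sup>2 / (\<alpha> k * (\<tau> k)\<^sup>2)"
  unfolding B_coef_def A_coef_def Suc_eq_plus1 power_mult_distrib by (simp add: right_diff_distrib)

lemma step_coef_eq: "step_coef B0 \<alpha> \<tau> k = inverse (ereal (A k) / ereal (B k) + ereal (A k / (\<alpha> k * (\<tau> k)\<^sup>2)))"
proof -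
  have "(B (k + 1) + (\<alpha> (k + 1))\<^sup>2 * (\<tau> (k + 1))\<^sup>2) / A k = A k / (\<alpha> k * (\<tau> k)\<^sup>2)"
    using B_Suc[of k] A_pos[of k] by (simp add: power2_eq_square)
  moreover have "ereal p / ereal (A k) = ereal (p / A k)" for p
    using A_pos[of k] by simp
  ultimately show ?thesis by (simp only: step_coef_def)
qed

text \<open>Extended-real division makes \<open>A k / 0\<close> infinite, and its inverse
  \<open>0\<close> contradicts the positive lower bound.\<close>

lemma B_nonzero: "B k \<noteq> 0"
proof
  assume B: "B k = 0"
  have "step_coef B0 \<alpha> \<tau> k = 0"
    unfolding step_coef_eq B using A_pos[of k] by (simp add: divide_ereal_def)
  then show False
    using step_coef_ge[of k] r_pos \<alpha>_pos[of "k + 1"] by (simp add: divide_le_0_iff)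
qed

lemma step_coef_inverse: "step_coef B0 \<alpha> \<tau> k = inverse (ereal (c k))"
  using B_nonzero[of k] by (simp add: step_coef_eq)

text \<open>Equality is not excluded yet, since the inverse of \<open>0\<close> is infinite and
  meets the lower bound; \<open>B_pos\<close> later gives strictness.\<close>

lemma c_nonneg: "c k \<ge> 0"
proof (rule ccontr)
  assume "\<not> c k \<ge> 0"
  then have "step_coef B0 \<alpha> \<tau> k < 0"
    unfolding step_coef_inverse by (simp add: not_le)
  moreover have "ereal (r / \<alpha> (k + 1)) > 0"
    using r_pos \<alpha>_pos[of "k + 1"] by simp
  ultimately show False
    using step_coef_ge[of k] by (metis less_le_trans not_less_iff_gr_or_eq)
qed

text \<open>Since \<open>B k > - (\<alpha> k)\<^sup>2 (\<tau> k)\<^sup>2 \<ge> - \<alpha> k (\<tau> k)\<^sup>2\<close>, a negative \<open>B k\<close> would make \<open>c k\<close>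
  negative.\<close>

lemma B_pos: "B k > 0"
proof (rule ccontr)
  assume "\<not> B k > 0"
  then have neg: "B k < 0"
    using B_nonzero[of k] by simp
  then obtain j where j: "k = Suc j"
    using B0_pos by (cases k) (auto simp: B_coef_def)
  have "(A j)\<^sup>2 / (\<alpha> j * (\<tau> j)\<^sup>2) > 0"
    using A_pos[of j] \<alpha>\<tau>_pos[of j] by simp
  then have "- B k < (\<alpha> k)\<^sup>2 * (\<tau> k)\<^sup>2"
    using B_Suc[of j] j by simp
  also have "\<dots> \<le> \<alpha> k * (\<tau> k)\<^sup>2"
    using \<alpha>_pos[of k] \<alpha>_le[of k] by (intro mult_right_mono) (auto simp: power2_eq_square mult_left_le)
  finally have "A k / (\<alpha> k * (\<tau> k)\<^sup>2) < A k / - B k"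
    using neg A_pos[of k] \<alpha>\<tau>_pos[of k] by (intro divide_strict_left_mono mult_pos_pos[of "\<alpha> k * (\<tau> k)\<^sup>2"]) simp_all
  then have "c k < 0" by simp
  then show False using c_nonneg[of k] by simp
qed

lemma c_pos: "c k > 0"
  using A_pos[of k] B_pos[of k] \<alpha>\<tau>_pos[of k] by (simp add: add_pos_pos)

lemma r_le: "r / \<alpha> (Suc k) \<le> 1 / c k"
proof -
  have "inverse (ereal (c k)) = ereal (1 / c k)"
    using c_pos[of k] by (simp add: inverse_eq_divide)
  then show ?thesis
    using step_coef_ge[of k] unfolding step_coef_inverse by simp
qed

text \<open>Comes from positivity of \<open>B (Suc k)\<close>; it lets
  \<open>\<alpha> k * (\<tau> k)\<^sup>2\<close> stand for \<open>A k\<close> in the rates.\<close>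

lemma \<alpha>\<tau>_le_prod: "\<alpha> k * (\<tau> k)\<^sup>2 \<le> \<tau> (Suc k) * (\<tau> (Suc k) - 1)"
proof -
  have "(\<alpha> (Suc k))\<^sup>2 * (\<tau> (Suc k))\<^sup>2 * ((\<tau> (Suc k) - 1)\<^sup>2 / (\<alpha> k * (\<tau> k)\<^sup>2) - 1) > 0"
    using B_pos[of "Suc k"] by (simp add: B_coef_def)
  then have "(\<tau> (Suc k) - 1)\<^sup>2 / (\<alpha> k * (\<tau> k)\<^sup>2) - 1 > 0"
    using \<alpha>_pos[of "Suc k"] \<tau>_pos[of "Suc k"] by (metis zero_less_mult_pos zero_less_power mult_pos_pos)
  then have "\<alpha> k * (\<tau> k)\<^sup>2 < (\<tau> (Suc k) - 1)\<^sup>2"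
    using \<alpha>\<tau>_pos[of k] by (simp add: less_divide_eq)
  also have "\<dots> \<le> \<tau> (Suc k) * (\<tau> (Suc k) - 1)"
    unfolding power2_eq_square using \<tau>_gt1[of k] by (intro mult_right_mono) auto
  finally show ?thesis by simp
qed

lemma A_prev_0: "A_prev \<alpha> \<tau> 0 = 0"
  by (simp add: A_prev_def)

lemma A_prev_Suc: "A_prev \<alpha> \<tau> (Suc k) = A k"
  by (simp add: A_prev_def)

text \<open>At index \<open>0\<close> the corresponding sum is \<open>\<alpha> 0 * \<tau> 0\<close>,
  so the first step is treated apart.\<close>

lemma A_prev_sum_Suc: "A_prev \<alpha> \<tau> (Suc k) + \<alpha> (Suc k) * \<tau> (Suc k) = \<alpha> (Suc k) * (\<tau> (Suc k))\<^sup>2"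
  by (simp add: A_prev_Suc A_eq power2_eq_square algebra_simps)

end

section \<open>Lyapunov analysis\<close>

lemma norm_diff_scaleR_power2:
  fixes u v :: "'a::real_inner"
  shows "(norm (v - t *\<^sub>R u))\<^sup>2 = (norm v)\<^sup>2 - 2 * t * (v \<bullet> u) + t\<^sup>2 * (norm u)\<^sup>2"
  unfolding power2_norm_eq_inner
  by (simp add: inner_diff_left inner_diff_right inner_commute power2_eq_square algebra_simps)

text \<open>Here \<open>T\<close> and \<open>e\<close> stand for \<open>s\<^bsub>k+1\<^esub> A\<^bsub>k\<^esub>\<close> and \<open>1 / (\<alpha>\<^bsub>k\<^esub> \<tau>\<^bsub>k\<^esub>\<^sup>2)\<close>; the proof completes the square in \<open>v\<close>.\<close>

lemma quadratic_form_bound: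
  fixes u v :: "'a::real_inner"
  assumes "T > 0" "b > 0" "e \<ge> 0" "T * e \<le> 2 * q"
  shows "T * (2 * q - T * e) * (norm u)\<^sup>2 + T\<^sup>2 * e * (norm v)\<^sup>2
    \<le> T\<^sup>2 * (1 / b + e) * (norm (v - u))\<^sup>2 + 2 * T * q * (v \<bullet> u) + q\<^sup>2 * b * (norm u)\<^sup>2"
proof -
  \<comment> \<open>\<open>m *\<^sub>R u\<close> is the vertex in \<open>v\<close> of the difference
    of the two sides, where the squared norm of \<open>v\<close> has coefficient
    \<open>T\<^sup>2 / b\<close>.\<close>
  define m where "m = 1 + e * b - q * b / T"
  have "0 \<le> T\<^sup>2 / b * (norm (v - m *\<^sub>R u))\<^sup>2 + T * (2 * q - T * e) * (e * b) * (norm u)\<^sup>2"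
    using assms by simp
  also have "\<dots> = T\<^sup>2 * (1 / b + e) * (norm (v - u))\<^sup>2 + 2 * T * q * (v \<bullet> u) + q\<^sup>2 * b * (norm u)\<^sup>2
      - (T * (2 * q - T * e) * (norm u)\<^sup>2 + T\<^sup>2 * e * (norm v)\<^sup>2)"
    using assms(1,2) unfolding norm_diff_scaleR_power2 norm_diff_scaleR_power2[of v 1 u, simplified]
    by (simp add: m_def field_simps power2_eq_square)
  finally show ?thesis by simp
qed

locale adanag_run = smooth_convex f L + adanag_params B0 r \<alpha> \<tau>
  for f :: "'a::euclidean_space \<Rightarrow> real" and L B0 r \<alpha> \<tau> +
  fixes xs x0 xt0 :: 'a and L0 s0 :: real and x y z :: "nat \<Rightarrow> 'a" and s :: "nat \<Rightarrow> real"
  assumes minimizer: "f xs \<le> f u"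
    and xt0: "x0 \<noteq> xt0"
    and L0: "L0 = norm (grad f x0 - grad f xt0) / norm (x0 - xt0)" "L0 > 0"
    and s0: "s0 = A_coef \<alpha> \<tau> 0 / (\<alpha> 0 * \<tau> 0) * (r / \<alpha> 1) * (1 / L0)"
    and run: "AdaNAG_G B0 \<alpha> \<tau> f x0 s0 x y z s"
begin

abbreviation "g k \<equiv> grad f (x k)"
abbreviation "gap k \<equiv> f (x k) - f xs"

lemma init: "x 0 = x0" "z 0 = x0" "s 0 = s0"
  using run by (auto simp: AdaNAG_G_def)

lemma z_Suc: "z (Suc k) = z k - (s k * \<alpha> k * \<tau> k) *\<^sub>R g k"
  using run by (auto simp: AdaNAG_G_def)

text \<open>Eliminates \<open>y\<close> by solving the averaging step for
  \<open>z (Suc k)\<close>.\<close>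

lemma z_minus_x: "z (Suc k) - x (Suc k) = (\<tau> (Suc k) - 1) *\<^sub>R (x (Suc k) - x k + s k *\<^sub>R g k)"
proof -
  have y: "y (Suc k) = x k - s k *\<^sub>R g k"
    and x: "x (Suc k) = (1 - 1 / \<tau> (Suc k)) *\<^sub>R y (Suc k) + (1 / \<tau> (Suc k)) *\<^sub>R z (Suc k)"
    using run by (auto simp: AdaNAG_G_def)
  have "\<tau> (Suc k) *\<^sub>R x (Suc k) = (\<tau> (Suc k) * (1 - 1 / \<tau> (Suc k))) *\<^sub>R y (Suc k)
      + (\<tau> (Suc k) * (1 / \<tau> (Suc k))) *\<^sub>R z (Suc k)"
    by (subst x) (simp only: scaleR_add_right scaleR_scaleR)
  also have "\<dots> = (\<tau> (Suc k) - 1) *\<^sub>R y (Suc k) + z (Suc k)"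
    using \<tau>_pos[of "Suc k"] by (simp add: right_diff_distrib)
  finally have "z (Suc k) = \<tau> (Suc k) *\<^sub>R x (Suc k) - (\<tau> (Suc k) - 1) *\<^sub>R y (Suc k)"
    by simp
  then show ?thesis
    by (simp add: y algebra_simps)
qed

section \<open>Bounds on the step sizes\<close>

lemma s_Suc: "ereal (s (Suc k)) = min (ereal ((A_prev \<alpha> \<tau> k + \<alpha> k * \<tau> k) / A k * s k))
    (ereal (1 / c k) * (1 / ereal (local_L f (x k) (x (Suc k)))))"
proof -
  have "step_coef B0 \<alpha> \<tau> k = ereal (1 / c k)"
    using c_pos[of k] by (simp add: step_coef_inverse inverse_eq_divide)
  then show ?thesis
    using run by (simp add: AdaNAG_G_def)
qed

lemma s_growth: "s (Suc k) * A k \<le> (A_prev \<alpha> \<tau> k + \<alpha> k * \<tau> k) * s k"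
proof -
  have "ereal (s (Suc k)) \<le> ereal ((A_prev \<alpha> \<tau> k + \<alpha> k * \<tau> k) / A k * s k)"
    unfolding s_Suc by (rule min.cobounded1)
  then show ?thesis
    using A_pos[of k] by (simp add: field_simps)
qed

text \<open>The product form covers a vanishing \<open>local_L\<close>, where the second argument of
  the minimum is infinite.\<close>

lemma s_local: "s (Suc k) * c k * local_L f (x k) (x (Suc k)) \<le> 1"
proof (cases "local_L f (x k) (x (Suc k)) = 0")
  case False
  then have l: "local_L f (x k) (x (Suc k)) > 0"
    using local_L_bounds(1)[of "x k" "x (Suc k)"] by simp
  have "ereal (s (Suc k)) \<le> ereal (1 / c k) * (1 / ereal (local_L f (x k) (x (Suc k))))"
    unfolding s_Suc by (rule min.cobounded2)
  also have "\<dots> = ereal (1 / c k / local_L f (x k) (x (Suc k)))"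
    using l by (simp add: one_ereal_def)
  finally have "s (Suc k) \<le> 1 / c k / local_L f (x k) (x (Suc k))"
    by simp
  then show ?thesis
    using l c_pos[of k] by (simp add: pos_le_divide_eq mult_ac)
qed simp

text \<open>Only the first argument of the minimum has to be checked: the second always suffices, by
  \<open>r_le\<close> and the bound of \<open>local_L\<close> by \<open>L\<close>.\<close>

lemma s_step_lower:
  assumes "r / L \<le> (A_prev \<alpha> \<tau> k + \<alpha> k * \<tau> k) / A k * s k * \<alpha> (Suc k)"
  shows "r / L \<le> s (Suc k) * \<alpha> (Suc k)"
proof -
  have a: "\<alpha> (Suc k) > 0" by (rule \<alpha>_pos)
  have "ereal (r / L / \<alpha> (Suc k)) \<le> ereal ((A_prev \<alpha> \<tau> k + \<alpha> k * \<tau> k) / A k * s k)"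
    using assms a by (simp only: ereal_less_eq pos_divide_le_eq)
  moreover have "ereal (r / L / \<alpha> (Suc k)) \<le> ereal (1 / c k) * (1 / ereal (local_L f (x k) (x (Suc k))))"
  proof (cases "local_L f (x k) (x (Suc k)) = 0")
    case True
    then show ?thesis using c_pos[of k] by (simp add: divide_ereal_def)
  next
    case False
    then have l: "local_L f (x k) (x (Suc k)) > 0"
      using local_L_bounds(1)[of "x k" "x (Suc k)"] by simp
    have "r / L / \<alpha> (Suc k) = r / \<alpha> (Suc k) * (1 / L)"
      by simp
    also have "\<dots> \<le> 1 / c k * (1 / local_L f (x k) (x (Suc k)))"
      using r_le[of k] c_pos[of k] l L_pos local_L_bounds(2)[of "x k" "x (Suc k)"]
      by (intro mult_mono) (auto simp: frac_le)
    finally have "ereal (r / L / \<alpha> (Suc k)) \<le> ereal (1 / c k * (1 / local_L f (x k) (x (Suc k))))"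
      by (simp only: ereal_less_eq)
    also have "\<dots> = ereal (1 / c k) * (1 / ereal (local_L f (x k) (x (Suc k))))"
      using l by (simp add: one_ereal_def)
    finally show ?thesis .
  qed
  ultimately have "ereal (r / L / \<alpha> (Suc k)) \<le> ereal (s (Suc k))"
    unfolding s_Suc by simp
  then show ?thesis
    using a by (simp only: ereal_less_eq pos_divide_le_eq)
qed

text \<open>The choice of \<open>s0\<close> makes the first argument of the minimum, times
  \<open>\<alpha> 1\<close>, equal to \<open>r / L0\<close>, and \<open>L0 \<le> L\<close>.
  Afterwards the ratio condition on \<open>\<tau>\<close> preserves the bound.\<close>

lemma s_lower: "r / L \<le> s (Suc k) * \<alpha> (Suc k)"
proof (induction k)
  case 0
  have "L0 \<le> L"
    using grad_lipschitz[of x0 xt0] xt0 by (simp add: L0(1) pos_divide_le_eq)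
  then have "r / L \<le> r / L0"
    using L0(2) r_pos by (simp add: frac_le)
  also have "r / L0 = (A_prev \<alpha> \<tau> 0 + \<alpha> 0 * \<tau> 0) / A 0 * s 0 * \<alpha> (Suc 0)"
    using A_pos[of 0] \<alpha>_pos[of 0] \<alpha>_pos[of 1] \<tau>_pos[of 0] L0(2)
    by (simp add: A_prev_0 init s0)
  finally show ?case by (rule s_step_lower)
next
  case (Suc k)
  let ?P = "\<tau> (Suc (Suc k)) * (\<tau> (Suc (Suc k)) - 1)"
  have pos: "s (Suc k) * \<alpha> (Suc k) > 0"
    using Suc r_pos L_pos by (meson divide_pos_pos less_le_trans)
  have "r / L \<le> s (Suc k) * \<alpha> (Suc k) * 1" using Suc by simp
  also have "\<dots> \<le> s (Suc k) * \<alpha> (Suc k) * ((\<tau> (Suc k))\<^sup>2 / ?P)"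
    using pos \<tau>_prod_le[of "Suc k"] \<tau>_prod_pos[of "Suc k"]
    by (intro mult_left_mono) (auto simp: le_divide_eq)
  also have "\<dots> = (A_prev \<alpha> \<tau> (Suc k) + \<alpha> (Suc k) * \<tau> (Suc k)) / A (Suc k) * s (Suc k) * \<alpha> (Suc (Suc k))"
    unfolding A_prev_sum_Suc A_eq[of "Suc k"]
    using \<tau>_prod_pos[of "Suc k"] \<alpha>_pos[of "Suc (Suc k)"] by (simp add: divide_simps)
  finally show ?case by (rule s_step_lower)
qed

lemma s_pos: "s k > 0"
proof (cases k)
  case 0
  then show ?thesis
    using A_pos[of 0] \<alpha>_pos[of 0] \<alpha>_pos[of 1] \<tau>_pos[of 0] L0(2) r_pos by (simp add: init s0)
next
  case (Suc j)
  have "s (Suc j) * \<alpha> (Suc j) > 0"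
    using s_lower[of j] r_pos L_pos by (meson divide_pos_pos less_le_trans)
  then show ?thesis
    using Suc \<alpha>_pos[of "Suc j"] by (simp add: zero_less_mult_iff)
qed

lemma sA_lower: "r / L * (\<alpha> k * (\<tau> k)\<^sup>2) \<le> s (Suc k) * A k"
proof -
  have "r / L * (\<alpha> k * (\<tau> k)\<^sup>2) \<le> (s (Suc k) * \<alpha> (Suc k)) * (\<tau> (Suc k) * (\<tau> (Suc k) - 1))"
    using s_lower[of k] \<alpha>\<tau>_le_prod[of k] r_pos L_pos \<alpha>\<tau>_pos[of k] s_pos[of "Suc k"] \<alpha>_pos[of "Suc k"]
    by (intro mult_mono[of "r / L"]) (simp_all add: less_imp_le)
  then show ?thesis by (simp add: A_eq mult_ac)
qed

lemma sA_upper: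
  "s 1 * A 0 * (1 / (\<alpha> 0 * (\<tau> 0)\<^sup>2)) \<le> 2 * s 0"
  "s (Suc (Suc k)) * A (Suc k) * (1 / (\<alpha> (Suc k) * (\<tau> (Suc k))\<^sup>2)) \<le> s (Suc k)"
proof -
  have "s 1 * A 0 \<le> \<alpha> 0 * \<tau> 0 * s 0"
    using s_growth[of 0] by (simp add: A_prev_0)
  \<comment> \<open>The condition \<open>\<tau> 0 \<ge> 1 / 2\<close> enters here, as
    \<open>2 * \<tau> 0 \<ge> 1\<close>.\<close>
  also have "\<dots> \<le> \<alpha> 0 * \<tau> 0 * s 0 * (2 * \<tau> 0)"
    using \<tau>0 \<alpha>_pos[of 0] \<tau>_pos[of 0] s_pos[of 0] by simp
  also have "\<dots> = 2 * s 0 * (\<alpha> 0 * (\<tau> 0)\<^sup>2)"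
    by (simp add: power2_eq_square)
  finally show "s 1 * A 0 * (1 / (\<alpha> 0 * (\<tau> 0)\<^sup>2)) \<le> 2 * s 0"
    using \<alpha>\<tau>_pos[of 0] by (simp add: pos_divide_le_eq)
  show "s (Suc (Suc k)) * A (Suc k) * (1 / (\<alpha> (Suc k) * (\<tau> (Suc k))\<^sup>2)) \<le> s (Suc k)"
    using s_growth[of "Suc k"] \<alpha>\<tau>_pos[of "Suc k"] unfolding A_prev_sum_Suc
    by (simp add: pos_divide_le_eq mult.commute)
qed

section \<open>Lyapunov function and its decrease\<close>

lemma gap_nonneg: "gap k \<ge> 0"
  using minimizer by simp

text \<open>Cocoercivity between \<open>x k\<close> and the minimizer, where the gradient vanishes.
  The squared term supplies the surplus in \<open>W_0_le\<close>.\<close>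

lemma gap_le: "gap k + (norm (g k))\<^sup>2 / (2 * L) \<le> g k \<bullet> (x k - xs)"
  using cocoercive[of "x k" xs] grad_minimizer[OF minimizer] by (simp add: inner_diff_right)

definition W :: "nat \<Rightarrow> real" where
  "W k = (norm (z (Suc k) - xs))\<^sup>2 + 2 * s (Suc k) * A k * gap k + (s k)\<^sup>2 * B k * (norm (g k))\<^sup>2"

lemma W_ge_gap: "2 * s (Suc k) * A k * gap k \<le> W k"
  unfolding W_def using B_pos[of k] by simp

lemma W_nonneg: "W k \<ge> 0"
  by (rule order_trans[OF _ W_ge_gap]) (use s_pos[of "Suc k"] A_pos[of k] gap_nonneg[of k] in simp)

lemma norm_z_Suc: "(norm (z (Suc k) - xs))\<^sup>2 = (norm (z k - xs))\<^sup>2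
    - 2 * (s k * \<alpha> k * \<tau> k) * (g k \<bullet> (z k - xs)) + (s k)\<^sup>2 * ((\<alpha> k)\<^sup>2 * (\<tau> k)\<^sup>2) * (norm (g k))\<^sup>2"
proof -
  have "z (Suc k) - xs = (z k - xs) - (s k * \<alpha> k * \<tau> k) *\<^sub>R g k"
    by (simp add: z_Suc)
  then show ?thesis
    by (simp only: norm_diff_scaleR_power2 power_mult_distrib inner_commute mult.assoc)
qed

text \<open>Since \<open>A\<close> is \<open>0\<close> at index \<open>-1\<close>, the gap in
  \<open>W 0\<close> has coefficient at most \<open>2 * (\<alpha> 0 * \<tau> 0 * s 0)\<close>, which
  the first update of \<open>z\<close> absorbs through \<open>gap_le\<close>.\<close>

lemma W_0_le: "W 0 + s0 * \<alpha> 0 * \<tau> 0 / L * (norm (g 0))\<^sup>2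
    \<le> (norm (x0 - xs))\<^sup>2 + s0\<^sup>2 * (B0 + (\<alpha> 0)\<^sup>2 * (\<tau> 0)\<^sup>2) * (norm (g 0))\<^sup>2"
proof -
  have "2 * (s 1 * A 0) * gap 0 \<le> 2 * (\<alpha> 0 * \<tau> 0 * s 0) * gap 0"
    using s_growth[of 0] gap_nonneg[of 0] by (intro mult_right_mono) (auto simp: A_prev_0)
  moreover have "2 * (s 0 * \<alpha> 0 * \<tau> 0) * (gap 0 + (norm (g 0))\<^sup>2 / (2 * L))
      \<le> 2 * (s 0 * \<alpha> 0 * \<tau> 0) * (g 0 \<bullet> (x 0 - xs))"
    using s_pos[of 0] \<alpha>_pos[of 0] \<tau>_pos[of 0] by (intro mult_left_mono gap_le) auto
  moreover have "B 0 = B0" by (simp add: B_coef_def)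
  ultimately show ?thesis
    unfolding W_def norm_z_Suc[of 0] using L_pos by (simp add: init algebra_simps)
qed

lemma W_step:
  assumes "s (Suc k) * A k * (1 / (\<alpha> k * (\<tau> k)\<^sup>2)) \<le> 2 * s k"
  shows "W (Suc k) + s (Suc k) * A k * (2 * s k - s (Suc k) * A k * (1 / (\<alpha> k * (\<tau> k)\<^sup>2))) * (norm (g k))\<^sup>2
    \<le> W k"
proof -
  define T where "T = s (Suc k) * A k"
  define e where "e = 1 / (\<alpha> k * (\<tau> k)\<^sup>2)"
  define p where "p = s (Suc k) * \<alpha> (Suc k) * \<tau> (Suc k)"
  \<comment> \<open>\<open>D\<close> is the Bregman divergence of \<open>f\<close> at
    \<open>x k\<close> from \<open>x (Suc k)\<close>, which \<open>local_L\<close> compares with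
    \<open>G\<close>.\<close>
  define D where "D = gap k - gap (Suc k) - g (Suc k) \<bullet> (x k - x (Suc k))"
  define G where "G = (norm (g (Suc k) - g k))\<^sup>2"
  have T: "T > 0" using s_pos[of "Suc k"] A_pos[of k] by (simp add: T_def)
  have p: "p > 0" using s_pos[of "Suc k"] \<alpha>_pos[of "Suc k"] \<tau>_pos[of "Suc k"] by (simp add: p_def)
  have Tp: "p * (\<tau> (Suc k) - 1) = T"
    by (simp add: T_def p_def A_eq)
  have D: "s (Suc k) * c k * G \<le> 2 * D"
  proof -
    have l: "local_L f (x k) (x (Suc k)) * D = G / 2"
      using local_L_bounds(3)[of "x k" "x (Suc k)"] by (simp add: D_def G_def)
    have "D \<ge> 0"
      using above_tangent[of "x (Suc k)" "x k"] by (simp add: D_def)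
    then have "s (Suc k) * c k * local_L f (x k) (x (Suc k)) * D \<le> 1 * D"
      by (intro mult_right_mono s_local)
    then show ?thesis using l by (simp add: mult.assoc)
  qed
  have "T\<^sup>2 * (1 / B k + e) * G = T * (s (Suc k) * c k * G)"
    by (simp add: T_def e_def power2_eq_square algebra_simps)
  also have "\<dots> \<le> T * (2 * D)"
    using D T by (intro mult_left_mono) auto
  finally have TD: "T\<^sup>2 * (1 / B k + e) * G \<le> 2 * T * D" by simp
  \<comment> \<open>The terms on the right are what \<open>2 * T * D\<close>, the \<open>z\<close>
    update and \<open>W k\<close> offer to pay for the new gradient term.\<close>
  have Q: "T * (2 * s k - T * e) * (norm (g k))\<^sup>2 + T\<^sup>2 * e * (norm (g (Suc k)))\<^sup>2
      \<le> T\<^sup>2 * (1 / B k + e) * G + 2 * T * s k * (g (Suc k) \<bullet> g k) + (s k)\<^sup>2 * B k * (norm (g k))\<^sup>2"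
    unfolding G_def
  proof (rule quadratic_form_bound)
    show "e \<ge> 0" using \<alpha>\<tau>_pos[of k] by (simp add: e_def)
    show "T * e \<le> 2 * s k" using assms by (simp add: T_def e_def)
  qed (use T B_pos in auto)
  have "p * (g (Suc k) \<bullet> (z (Suc k) - xs))
      = p * (g (Suc k) \<bullet> (x (Suc k) - xs)) + p * (g (Suc k) \<bullet> (z (Suc k) - x (Suc k)))"
    by (simp add: inner_diff_right algebra_simps)
  also have "p * (g (Suc k) \<bullet> (z (Suc k) - x (Suc k)))
      = T * (g (Suc k) \<bullet> (x (Suc k) - x k + s k *\<^sub>R g k))"
    by (simp add: z_minus_x Tp[symmetric])
  also have "\<dots> = T * (D - gap k + gap (Suc k)) + T * s k * (g (Suc k) \<bullet> g k)"
    by (simp add: D_def inner_add_right inner_diff_right algebra_simps)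
  finally have pz: "p * (g (Suc k) \<bullet> (z (Suc k) - xs)) = p * (g (Suc k) \<bullet> (x (Suc k) - xs))
      + T * (D - gap k + gap (Suc k)) + T * s k * (g (Suc k) \<bullet> g k)" by simp
  have "gap (Suc k) \<le> g (Suc k) \<bullet> (x (Suc k) - xs)"
    using gap_le[of "Suc k"] L_pos by (smt (verit) divide_nonneg_pos zero_le_power2)
  then have pg: "p * gap (Suc k) \<le> p * (g (Suc k) \<bullet> (x (Suc k) - xs))"
    using p by (intro mult_left_mono) auto
  \<comment> \<open>The coefficient \<open>T + p\<close> is matched exactly by \<open>T\<close> from
    \<open>pz\<close> and \<open>p\<close> from \<open>pg\<close>, so the new gap cancels.\<close>
  have "s (Suc (Suc k)) * A (Suc k) * gap (Suc k)
      \<le> (A_prev \<alpha> \<tau> (Suc k) + \<alpha> (Suc k) * \<tau> (Suc k)) * s (Suc k) * gap (Suc k)"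
    by (intro mult_right_mono s_growth gap_nonneg)
  also have "\<dots> = (T + p) * gap (Suc k)"
    by (simp add: A_prev_Suc T_def p_def algebra_simps)
  finally have sg: "s (Suc (Suc k)) * A (Suc k) * gap (Suc k) \<le> (T + p) * gap (Suc k)" .
  have E: "(s (Suc k))\<^sup>2 * (B (Suc k) + (\<alpha> (Suc k))\<^sup>2 * (\<tau> (Suc k))\<^sup>2) = T\<^sup>2 * e"
    unfolding B_Suc by (simp add: T_def e_def power_mult_distrib)
  have "W (Suc k) = (norm (z (Suc k) - xs))\<^sup>2 - 2 * (p * (g (Suc k) \<bullet> (z (Suc k) - xs)))
      + 2 * (s (Suc (Suc k)) * A (Suc k) * gap (Suc k))
      + ((s (Suc k))\<^sup>2 * (B (Suc k) + (\<alpha> (Suc k))\<^sup>2 * (\<tau> (Suc k))\<^sup>2)) * (norm (g (Suc k)))\<^sup>2"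
    unfolding W_def norm_z_Suc[of "Suc k"] p_def[symmetric] by (simp add: algebra_simps)
  also have "\<dots> \<le> (norm (z (Suc k) - xs))\<^sup>2 + 2 * T * gap k - 2 * T * D
      - 2 * T * s k * (g (Suc k) \<bullet> g k) + T\<^sup>2 * e * (norm (g (Suc k)))\<^sup>2"
    unfolding E pz using pg sg by (simp add: algebra_simps)
  also have "\<dots> \<le> (norm (z (Suc k) - xs))\<^sup>2 + 2 * T * gap k + (s k)\<^sup>2 * B k * (norm (g k))\<^sup>2
      - T * (2 * s k - T * e) * (norm (g k))\<^sup>2"
    using Q TD by linarith
  also have "\<dots> = W k - T * (2 * s k - T * e) * (norm (g k))\<^sup>2"
    by (simp add: W_def T_def)
  finally show ?thesis
    by (simp add: T_def e_def)
qed

lemma W_1_le: "W 1 \<le> W 0"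
proof -
  have "s 1 * A 0 * (2 * s 0 - s 1 * A 0 * (1 / (\<alpha> 0 * (\<tau> 0)\<^sup>2))) * (norm (g 0))\<^sup>2 \<ge> 0"
    using sA_upper(1) s_pos[of 1] A_pos[of 0] by (intro mult_nonneg_nonneg) auto
  then show ?thesis
    using W_step[of 0] sA_upper(1) by simp
qed

text \<open>One factor \<open>r / L\<close> comes from \<open>sA_lower\<close>, the other from the
  bracket, where \<open>\<alpha> (Suc k) \<le> 1\<close> turns \<open>s_lower\<close> into a bound
  on \<open>s (Suc k)\<close> itself.\<close>

lemma W_Suc_le: "W (Suc (Suc k)) + (r / L)\<^sup>2 * (\<alpha> (Suc k) * (\<tau> (Suc k))\<^sup>2 * (norm (g (Suc k)))\<^sup>2) \<le> W (Suc k)"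
proof -
  let ?T = "s (Suc (Suc k)) * A (Suc k)"
  let ?e = "1 / (\<alpha> (Suc k) * (\<tau> (Suc k))\<^sup>2)"
  have te: "?T * ?e \<le> s (Suc k)" by (rule sA_upper)
  have "r / L \<le> s (Suc k) * \<alpha> (Suc k)" by (rule s_lower)
  also have "\<dots> \<le> s (Suc k)"
    using s_pos[of "Suc k"] \<alpha>_le[of "Suc k"] by (simp add: mult_left_le)
  also have "\<dots> \<le> 2 * s (Suc k) - ?T * ?e"
    using te by simp
  finally have "(r / L * (\<alpha> (Suc k) * (\<tau> (Suc k))\<^sup>2)) * (r / L) \<le> ?T * (2 * s (Suc k) - ?T * ?e)"
    using sA_lower[of "Suc k"] r_pos L_pos s_pos[of "Suc (Suc k)"] A_pos[of "Suc k"]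
    by (intro mult_mono[of "r / L * (\<alpha> (Suc k) * (\<tau> (Suc k))\<^sup>2)"]) (simp_all add: less_imp_le)
  then have "(r / L * (\<alpha> (Suc k) * (\<tau> (Suc k))\<^sup>2)) * (r / L) * (norm (g (Suc k)))\<^sup>2
      \<le> ?T * (2 * s (Suc k) - ?T * ?e) * (norm (g (Suc k)))\<^sup>2"
    by (intro mult_right_mono) auto
  moreover have "(r / L * (\<alpha> (Suc k) * (\<tau> (Suc k))\<^sup>2)) * (r / L) * (norm (g (Suc k)))\<^sup>2
      = (r / L)\<^sup>2 * (\<alpha> (Suc k) * (\<tau> (Suc k))\<^sup>2 * (norm (g (Suc k)))\<^sup>2)"
    by (simp add: power2_eq_square)
  moreover have "W (Suc (Suc k)) + ?T * (2 * s (Suc k) - ?T * ?e) * (norm (g (Suc k)))\<^sup>2 \<le> W (Suc k)"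
    using te s_pos[of "Suc k"] by (intro W_step) simp
  ultimately show ?thesis by linarith
qed

text \<open>Telescoping. The sum starts at \<open>1\<close> because \<open>W_1_le\<close> records no
  gradient term for index \<open>0\<close>.\<close>

lemma W_sum_le: "W (Suc k) + (r / L)\<^sup>2 * (\<Sum>i=1..k. \<alpha> i * (\<tau> i)\<^sup>2 * (norm (g i))\<^sup>2) \<le> W 0"
proof (induction k)
  case 0
  then show ?case using W_1_le by simp
next
  case (Suc k)
  then show ?case using W_Suc_le[of k] by (simp add: distrib_left)
qed

lemma W_le_0: "W k \<le> W 0"
proof (cases k)
  case (Suc j)
  have "(r / L)\<^sup>2 * (\<Sum>i=1..j. \<alpha> i * (\<tau> i)\<^sup>2 * (norm (g i))\<^sup>2) \<ge> 0"
    using \<alpha>_pos by (intro mult_nonneg_nonneg sum_nonneg) (auto simp: less_imp_le)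
  then show ?thesis using W_sum_le[of j] Suc by simp
qed simp

section \<open>Convergence rates\<close>

lemma gap_bound: "gap k \<le> 1 / (2 * s (Suc k) * A k) * W 0"
proof -
  have "2 * s (Suc k) * A k > 0"
    using s_pos[of "Suc k"] A_pos[of k] by simp
  moreover have "2 * s (Suc k) * A k * gap k \<le> W 0"
    using W_ge_gap[of k] W_le_0[of k] by simp
  ultimately show ?thesis
    by (simp add: pos_le_divide_eq mult.commute)
qed

lemma rate_coef: "1 / (2 * s (Suc k) * A k) \<le> 1 / (2 * r) * (L / (\<alpha> k * (\<tau> k)\<^sup>2))"
proof -
  have "1 / (2 * s (Suc k) * A k) \<le> 1 / (2 * (r / L * (\<alpha> k * (\<tau> k)\<^sup>2)))"
  proof (rule frac_le)
    show "0 < 2 * (r / L * (\<alpha> k * (\<tau> k)\<^sup>2))"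
      using r_pos L_pos \<alpha>\<tau>_pos[of k] by simp
  qed (use sA_lower[of k] in simp_all)
  then show ?thesis by simp
qed

text \<open>The minimum is at most the mean with weights
  \<open>\<alpha> i * (\<tau> i)\<^sup>2\<close>, which \<open>W_sum_le\<close> controls.\<close>

lemma min_grad_bound:
  assumes "k \<ge> 1"
  shows "Min ((\<lambda>i. (norm (g i))\<^sup>2) ` {1..k}) \<le> 1 / r\<^sup>2 * W 0 * (L\<^sup>2 / (\<Sum>i=1..k. \<alpha> i * (\<tau> i)\<^sup>2))"
proof -
  let ?m = "Min ((\<lambda>i. (norm (g i))\<^sup>2) ` {1..k})"
  let ?S = "\<Sum>i=1..k. \<alpha> i * (\<tau> i)\<^sup>2"
  have S: "?S > 0"
    using assms \<alpha>\<tau>_pos by (intro sum_pos) auto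
  have "?m * ?S = (\<Sum>i=1..k. \<alpha> i * (\<tau> i)\<^sup>2 * ?m)"
    by (simp only: sum_distrib_right[symmetric] mult.commute)
  also have "\<dots> \<le> (\<Sum>i=1..k. \<alpha> i * (\<tau> i)\<^sup>2 * (norm (g i))\<^sup>2)"
    using \<alpha>\<tau>_pos by (intro sum_mono mult_left_mono Min_le) (auto simp: less_imp_le)
  finally have "(r / L)\<^sup>2 * (?m * ?S) \<le> (r / L)\<^sup>2 * (\<Sum>i=1..k. \<alpha> i * (\<tau> i)\<^sup>2 * (norm (g i))\<^sup>2)"
    by (intro mult_left_mono) auto
  also have "\<dots> \<le> W 0"
    using W_sum_le[of k] W_nonneg[of "Suc k"] by simp
  finally show ?thesis
    using S r_pos L_pos by (simp add: field_simps power_divide)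
qed

end

text \<open>The constant \<open>C\<close> of the asymptotic bounds is quantified before
  \<open>f\<close>, \<open>L\<close> and the run, so it is uniform in them; \<open>R\<close> stays
  explicit.\<close>

theorem theorem6:
  fixes \<alpha> \<tau> :: "nat \<Rightarrow> real" and B0 r :: real
  assumes "B0 > 0" and "r > 0"
    and "\<forall>k. \<tau> k > 0" and "\<tau> 0 \<ge> 1 / 2"
    and "\<forall>k. 0 < \<alpha> k \<and> \<alpha> k \<le> 1"
    and "\<forall>k. (\<tau> k)\<^sup>2 / (\<tau> (k + 1) * (\<tau> (k + 1) - 1)) \<ge> 1"
    and "\<forall>k. step_coef B0 \<alpha> \<tau> k \<ge> ereal (r / \<alpha> (k + 1))"
  shows "\<exists>C>0. \<forall>(f :: real ^ 'd \<Rightarrow> real) L xstar x0 xt0 L0 s0 R x y z s.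
    convex_on UNIV f \<longrightarrow> L_smooth L f \<longrightarrow> (\<forall>u. f xstar \<le> f u) \<longrightarrow>
    x0 \<noteq> xt0 \<longrightarrow>
    L0 = norm (grad f x0 - grad f xt0) / norm (x0 - xt0) \<longrightarrow> L0 > 0 \<longrightarrow>
    s0 = A_coef \<alpha> \<tau> 0 / (\<alpha> 0 * \<tau> 0) * (r / \<alpha> 1) * (1 / L0) \<longrightarrow>
    R = (norm (x0 - xstar))\<^sup>2 +
        (s0\<^sup>2 * (B0 + (\<alpha> 0)\<^sup>2 * (\<tau> 0)\<^sup>2) - s0 * \<alpha> 0 * \<tau> 0 / (2 * L)) * (norm (grad f x0))\<^sup>2 \<longrightarrow>
    AdaNAG_G B0 \<alpha> \<tau> f x0 s0 x y z s \<longrightarrow>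
      (\<forall>k. s (k + 1) * \<alpha> (k + 1) \<ge> r / L) \<and>
      (\<forall>k. f (x k) - f xstar \<le> 1 / (2 * s (k + 1) * A_coef \<alpha> \<tau> k) * R) \<and>
      (\<forall>k. 1 / (2 * s (k + 1) * A_coef \<alpha> \<tau> k) * R \<le> C * R * (L / (\<alpha> k * (\<tau> k)\<^sup>2))) \<and>
      (\<forall>k\<ge>1. Min ((\<lambda>i. (norm (grad f (x i)))\<^sup>2) ` {1..k})
               \<le> C * R * (L\<^sup>2 / (\<Sum>i=1..k. \<alpha> i * (\<tau> i)\<^sup>2)))"
proof (intro exI[of _ "1 / (2 * r) + 1 / r\<^sup>2"] conjI allI impI)
  \<comment> \<open>The first summand serves the function values, the second the gradients.\<close>
  let ?C = "1 / (2 * r) + 1 / r\<^sup>2"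
  show "?C > 0" using \<open>r > 0\<close> by (simp add: add_pos_pos)
  fix f :: "real ^ 'd \<Rightarrow> real" and L :: real and xstar x0 xt0 :: "real ^ 'd"
    and L0 s0 R :: real and x y z :: "nat \<Rightarrow> real ^ 'd" and s :: "nat \<Rightarrow> real"
  assume *: "convex_on UNIV f" "L_smooth L f" "\<forall>u. f xstar \<le> f u" "x0 \<noteq> xt0"
    "L0 = norm (grad f x0 - grad f xt0) / norm (x0 - xt0)" "L0 > 0"
    "s0 = A_coef \<alpha> \<tau> 0 / (\<alpha> 0 * \<tau> 0) * (r / \<alpha> 1) * (1 / L0)"
    and R: "R = (norm (x0 - xstar))\<^sup>2 +
        (s0\<^sup>2 * (B0 + (\<alpha> 0)\<^sup>2 * (\<tau> 0)\<^sup>2) - s0 * \<alpha> 0 * \<tau> 0 / (2 * L)) * (norm (grad f x0))\<^sup>2"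
    and run: "AdaNAG_G B0 \<alpha> \<tau> f x0 s0 x y z s"
  interpret adanag_run f L B0 r \<alpha> \<tau> xstar x0 xt0 L0 s0 x y z s
    using assms * run by unfold_locales auto
  have "s0 * \<alpha> 0 * \<tau> 0 / (2 * L) * (norm (grad f x0))\<^sup>2 \<ge> 0"
    using s_pos[of 0] \<alpha>_pos[of 0] \<tau>_pos[of 0] L_pos by (simp add: init)
  then have W0R: "W 0 \<le> R"
    using W_0_le L_pos unfolding R init by (simp add: field_simps)
  then have R_nonneg: "R \<ge> 0"
    using W_nonneg[of 0] by simp
  show "r / L \<le> s (k + 1) * \<alpha> (k + 1)" for k
    using s_lower by simp
  show "f (x k) - f xstar \<le> 1 / (2 * s (k + 1) * A_coef \<alpha> \<tau> k) * R" for k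
  proof -
    have "1 / (2 * s (Suc k) * A k) * W 0 \<le> 1 / (2 * s (Suc k) * A k) * R"
      using W0R s_pos[of "Suc k"] A_pos[of k] by (intro mult_left_mono) auto
    then show ?thesis using gap_bound[of k] by simp
  qed
  show "1 / (2 * s (k + 1) * A_coef \<alpha> \<tau> k) * R \<le> ?C * R * (L / (\<alpha> k * (\<tau> k)\<^sup>2))" for k
  proof -
    have "1 / (2 * s (Suc k) * A k) * R \<le> (1 / (2 * r) * (L / (\<alpha> k * (\<tau> k)\<^sup>2))) * R"
      by (intro mult_right_mono rate_coef R_nonneg)
    also have "\<dots> \<le> (?C * (L / (\<alpha> k * (\<tau> k)\<^sup>2))) * R"
      using \<alpha>\<tau>_pos[of k] L_pos R_nonneg by (intro mult_right_mono) auto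
    finally show ?thesis by (simp add: mult_ac)
  qed
  show "Min ((\<lambda>i. (norm (grad f (x i)))\<^sup>2) ` {1..k}) \<le> ?C * R * (L\<^sup>2 / (\<Sum>i=1..k. \<alpha> i * (\<tau> i)\<^sup>2))"
    if "1 \<le> k" for k
  proof -
    have "(\<Sum>i=1..k. \<alpha> i * (\<tau> i)\<^sup>2) \<ge> 0"
      using \<alpha>\<tau>_pos by (intro sum_nonneg) (auto simp: less_imp_le)
    then have "1 / r\<^sup>2 * W 0 * (L\<^sup>2 / (\<Sum>i=1..k. \<alpha> i * (\<tau> i)\<^sup>2))
        \<le> ?C * R * (L\<^sup>2 / (\<Sum>i=1..k. \<alpha> i * (\<tau> i)\<^sup>2))"
      using W0R W_nonneg[of 0] r_pos by (intro mult_right_mono mult_mono) auto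
    then show ?thesis using min_grad_bound[OF that] by linarith
  qed
qed

end
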